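(* Let $X$ be a $\pi$-regular $E$-semigroup. The following conditions are equivalent: (1) ${\Updownarrow}e=\sqrt[\infty]{H_e}$ for every $e\in E(X)$; (2) $X$ is $E$-separated; (3) $X$ is $E$-upcentral, $E$-hypocentral, and $E$-commutative.
   Context: For a semigroup $X$, $E(X)=\{x\in X:xx=x\}$ is the set of idempotents. $X$ is an $E$-semigroup if $E(X)$ is a subsemigroup of $X$. $X$ is $\pi$-regular if for every $x\in X$ there exist $n\ge1$ and $y\in X$ with $x^n=x^nyx^n$. A semilattice is a commutative semigroup of idempotents. $X^1=X\cup\{1\}$, where $1$ is an element with $1x=x=x1$ for all $x\in X^1$. For $e\in E(X)$, $H_e=\{x\in X: xX^1=eX^1\text{ and }X^1x=X^1e\}$ is the $\mathcal H$-class of $e$ (the maximal subgroup of $X$ containing $e$). For $A\subseteq X$, $\sqrt[\infty]{A}=\{x\in X:x^n\in A\text{ for some }n\ge1\}$. Let $\mathbf 2=\{0,1\}$ with the usual multiplication and the order $0\le1$. For $x,y\in X$ write $x\lesssim y$ if $\chi(x)\le\chi(y)$ for every homomorphism $\chi:X\to\mathbf 2$, and put ${\Updownarrow}a=\{x\in X: a\lesssim x\lesssim a\}$. The semigroup $X$ is called: - $E$-separated if for any distinct $x,y\in E(X)$ there is a homomorphism $h:X\to Y$ to a semilattice $Y$ with $h(x)\ne h(y)$; - $E$-commutative if $xy=yx$ for all $x,y\in E(X)$; - $E$-hypocentral if for any $e\in E(X)$ and $x,y\in X$ with $xy=e$ we have $xe=ex$ or $ye=ey$; - $E$-upcentral if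 for any $e,f\in E(X)$ with $fe=e=ef$ and any $x\in\sqrt[\infty]{H_f}$ we have $xe=ex$. *)

theory Defs
  imports Main
begin

text \<open>
  A semigroup is a binary operation on a type satisfying the locale predicate
  \<open>semigroup\<close>; a semilattice is one satisfying \<open>semilattice\<close>
  (associative, commutative and idempotent).
\<close>

definition semigroup_hom ::
    "('a \<Rightarrow> 'a \<Rightarrow> 'a) \<Rightarrow> ('b \<Rightarrow> 'b \<Rightarrow> 'b) \<Rightarrow> ('a \<Rightarrow> 'b) \<Rightarrow> bool" where
  "semigroup_hom f g h \<longleftrightarrow> (\<forall>x y. h (f x y) = g (h x) (h y))"

context
  fixes mul :: "'a \<Rightarrow> 'a \<Rightarrow> 'a"  (infixl "\<cdot>" 70)
begin

definition idempotents :: "'a set" where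
  "idempotents = {x. x \<cdot> x = x}"

definition E_semigroup :: bool where
  "E_semigroup \<longleftrightarrow> (\<forall>x \<in> idempotents. \<forall>y \<in> idempotents. x \<cdot> y \<in> idempotents)"

text \<open>
  The power \<open>x\<^sup>n\<close> for \<open>n \<ge> 1\<close>. There is no neutral element, so the value at
  \<open>n = 0\<close> is junk (it is \<open>x\<close>) and is excluded wherever powers are used.
\<close>

definition spow :: "'a \<Rightarrow> nat \<Rightarrow> 'a" where
  "spow x n = (((\<cdot>) x) ^^ (n - 1)) x"

definition pi_regular :: bool where
  "pi_regular \<longleftrightarrow> (\<forall>x. \<exists>n\<ge>1. \<exists>y. spow x n = spow x n \<cdot> y \<cdot> spow x n)"

text \<open>
  The principal one-sided ideals \<open>x X\<^sup>1\<close> and \<open>X\<^sup>1 x\<close>; the inserted \<open>x\<close> is the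
  product of \<open>x\<close> with the adjoined unit.
\<close>

definition right_ideal1 :: "'a \<Rightarrow> 'a set" where
  "right_ideal1 x = insert x {x \<cdot> y | y. True}"

definition left_ideal1 :: "'a \<Rightarrow> 'a set" where
  "left_ideal1 x = insert x {y \<cdot> x | y. True}"

definition H_class :: "'a \<Rightarrow> 'a set" where
  "H_class e = {x. right_ideal1 x = right_ideal1 e \<and> left_ideal1 x = left_ideal1 e}"

definition root_set :: "'a set \<Rightarrow> 'a set" where
  "root_set A = {x. \<exists>n\<ge>1. spow x n \<in> A}"

text \<open>
  Homomorphisms to \<open>{0, 1}\<close> with the usual multiplication and order are
  rendered as \<open>{0, 1}\<close>-valued functions into the natural numbers.
\<close>

definition characters :: "('a \<Rightarrow> nat) set" where
  "characters = {\<chi>. range \<chi> \<subseteq> {0, 1} \<and> semigroup_hom (\<cdot>) (*) \<chi>}"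

definition char_le :: "'a \<Rightarrow> 'a \<Rightarrow> bool" where
  "char_le x y \<longleftrightarrow> (\<forall>\<chi> \<in> characters. \<chi> x \<le> \<chi> y)"

definition updown :: "'a \<Rightarrow> 'a set" where
  "updown a = {x. char_le a x \<and> char_le x a}"

text \<open>
  HOL cannot quantify over the type carrying the semilattice \<open>Y\<close>, so \<open>Y\<close> is
  an arbitrary semilattice operation on the type \<open>'a set\<close>. This is no
  restriction: by \<open>semilattice_hom_to_set\<close> below, points of \<open>X\<close>
  separated by a homomorphism into a semilattice on any type whatsoever are
  separated by one into a semilattice on \<open>'a set\<close>.
\<close>

definition E_separated :: bool where
  "E_separated \<longleftrightarrow>
    (\<forall>x \<in> idempotents. \<forall>y \<in> idempotents. x \<noteq> y \<longrightarrow>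
      (\<exists>(g :: 'a set \<Rightarrow> 'a set \<Rightarrow> 'a set) h.
         semilattice g \<and> semigroup_hom (\<cdot>) g h \<and> h x \<noteq> h y))"

definition E_commutative :: bool where
  "E_commutative \<longleftrightarrow> (\<forall>x \<in> idempotents. \<forall>y \<in> idempotents. x \<cdot> y = y \<cdot> x)"

definition E_hypocentral :: bool where
  "E_hypocentral \<longleftrightarrow>
    (\<forall>e \<in> idempotents. \<forall>x y. x \<cdot> y = e \<longrightarrow> x \<cdot> e = e \<cdot> x \<or> y \<cdot> e = e \<cdot> y)"

definition E_upcentral :: bool where
  "E_upcentral \<longleftrightarrow>
    (\<forall>e \<in> idempotents. \<forall>f \<in> idempotents. f \<cdot> e = e \<and> e = e \<cdot> f \<longrightarrow>
      (\<forall>x \<in> root_set (H_class f). x \<cdot> e = e \<cdot> x))"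

end

lemma semilattice_hom_to_set:
  fixes mul :: "'a \<Rightarrow> 'a \<Rightarrow> 'a" and k :: "'b \<Rightarrow> 'b \<Rightarrow> 'b" and h :: "'a \<Rightarrow> 'b"
  assumes "semilattice k" and hom: "semigroup_hom mul k h" and ne: "h x \<noteq> h y"
  shows "\<exists>(g :: 'a set \<Rightarrow> 'a set \<Rightarrow> 'a set) h'.
           semilattice g \<and> semigroup_hom mul g h' \<and> h' x \<noteq> h' y"
proof -
  interpret semilattice k by fact
  define I where "I = (\<lambda>x. {z. k (h z) (h x) = h z})"
  have meet: "(k a (k b c) = a) \<longleftrightarrow> (k a b = a \<and> k a c = a)" for a b c
  proof
    assume *: "k a (k b c) = a"
    have "k a b = k (k a (k b c)) b" using * by simp
    also have "\<dots> = k a (k b c)" by (simp only: ac_simps left_idem)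
    finally have b: "k a b = a" using * by simp
    have "k a c = k (k a (k b c)) c" using * by simp
    also have "\<dots> = k a (k b c)" by (simp only: ac_simps idem)
    finally show "k a b = a \<and> k a c = a" using * b by simp
  next
    assume "k a b = a \<and> k a c = a"
    then show "k a (k b c) = a" by (simp only: assoc [symmetric])
  qed
  have "semigroup_hom mul (\<inter>) I"
    unfolding semigroup_hom_def
  proof (intro allI set_eqI)
    fix u v z
    have "h (mul u v) = k (h u) (h v)" using hom by (simp only: semigroup_hom_def)
    then show "z \<in> I (mul u v) \<longleftrightarrow> z \<in> I u \<inter> I v"
      by (simp only: I_def mem_Collect_eq Int_iff meet)
  qed
  moreover have "I x \<noteq> I y"
  proof
    assume "I x = I y"
    moreover have "x \<in> I x" "y \<in> I y" by (simp_all only: I_def mem_Collect_eq idem)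
    ultimately have "x \<in> I y" "y \<in> I x" by simp_all
    then have "k (h x) (h y) = h x" "k (h y) (h x) = h y" by (simp_all only: I_def mem_Collect_eq)
    with commute [of "h x" "h y"] ne show False by (simp only:)
  qed
  moreover have "semilattice ((\<inter>) :: 'a set \<Rightarrow> 'a set \<Rightarrow> 'a set)"
    by (rule inf.semilattice_axioms)
  ultimately show ?thesis by blast
qed

end

theory Submission
  imports Defs
begin

text \<open>
  All three conditions amount to one equation: whenever a product \<open>x \<cdot> y\<close> is an
  idempotent \<open>e\<close>, the rotated product \<open>y \<cdot> e \<cdot> x\<close>, which is always an idempotent, is
  again \<open>e\<close> (\<open>factorizations_rotate\<close> below).

  \<^item> If semilattices separate the idempotents, then the equation holds, because \<open>e\<close> and
    \<open>y \<cdot> e \<cdot> x\<close> have the same image in every semilattice. If \<open>X\<close> is \<open>E\<close>-hypocentral and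
    \<open>E\<close>-commutative, then hypocentrality, used once for \<open>x \<cdot> y\<close> and once for the rotated
    product, shows that each of the two idempotents lies below the other.

  \<^item> Conversely, the equation gives \<open>x \<cdot> e = x \<cdot> (y \<cdot> e \<cdot> x) = e \<cdot> x\<close>, and likewise for \<open>y\<close>:
    an idempotent commutes with each of its left and right divisors. All centrality
    conditions are instances of this. It also makes the left divisors of \<open>e\<close> coincide with
    the right divisors and form a subsemigroup. An element is a left divisor as soon as it
    occurs in a product that is one, so the indicator of this set is a character. It takes
    the value \<open>1\<close> at an idempotent \<open>f\<close> exactly if \<open>e \<le> f\<close>, and hence such characters
    separate the idempotents.

  \<^item> If \<open>a = x\<^sup>n\<close> is regular, \<open>a = a \<cdot> y \<cdot> a\<close>, then rotating the idempotent \<open>a \<cdot> y\<close> gives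
    \<open>y \<cdot> a = a \<cdot> y\<close>, so \<open>a\<close> lies in a maximal subgroup \<open>H\<^sub>f\<close>. Hence \<open>X\<close> is the union of
    the root sets of the groups \<open>H\<^sub>f\<close>. Characters are constant on each of these sets and, by
    the previous point, tell different ones apart, so the sets are the classes
    \<open>\<Updownarrow>f\<close>. If they are, then characters, and so semilattices, separate
    the idempotents, because \<open>H\<^sub>f\<close> contains no idempotent besides \<open>f\<close>.
\<close>

context
  fixes mul :: "'a \<Rightarrow> 'a \<Rightarrow> 'a"  (infixl "\<cdot>" 70)
  assumes semigroup: "semigroup mul"
begin

section \<open>Rotation of factorizations of idempotents\<close>

lemma mul_assoc: "x \<cdot> y \<cdot> z = x \<cdot> (y \<cdot> z)"
  using semigroup by (rule semigroup.assoc)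

definition factorizations_rotate :: bool where
  "factorizations_rotate \<longleftrightarrow> (\<forall>e \<in> idempotents mul. \<forall>x y. x \<cdot> y = e \<longrightarrow> y \<cdot> e \<cdot> x = e)"

lemma rotated_factorization_idempotent:
  assumes "x \<cdot> y = e" and "e \<in> idempotents mul"
  shows "y \<cdot> e \<cdot> x \<in> idempotents mul"
proof -
  have "y \<cdot> e \<cdot> x \<cdot> (y \<cdot> e \<cdot> x) = y \<cdot> (e \<cdot> (x \<cdot> y) \<cdot> e) \<cdot> x"
    by (simp only: mul_assoc)
  also have "\<dots> = y \<cdot> e \<cdot> x"
    using assms by (simp add: idempotents_def)
  finally show ?thesis
    by (simp add: idempotents_def)
qed

text \<open>
  In a commutative image the factors of \<open>y \<cdot> e \<cdot> x\<close> can be reordered to \<open>(x \<cdot> y) \<cdot> e = e\<close>.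
\<close>

lemma factorizations_rotate_if_separated:
  assumes "E_separated mul"
  shows factorizations_rotate
  unfolding factorizations_rotate_def
proof (intro ballI allI impI, rule ccontr)
  fix e x y
  assume e: "e \<in> idempotents mul" and xy: "x \<cdot> y = e" and "y \<cdot> e \<cdot> x \<noteq> e"
  then obtain g :: "'a set \<Rightarrow> 'a set \<Rightarrow> 'a set" and h
    where g: "semilattice g" and h: "semigroup_hom mul g h" and ne: "h (y \<cdot> e \<cdot> x) \<noteq> h e"
    using assms rotated_factorization_idempotent[OF xy e] unfolding E_separated_def by meson
  interpret semilattice g by fact
  have hom: "h (u \<cdot> v) = g (h u) (h v)" for u v
    using h by (simp add: semigroup_hom_def)
  have "h e = g (h x) (h y)"
    using xy hom by metis
  then have "h (y \<cdot> e \<cdot> x) = h e"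
    by (simp add: hom ac_simps)
  with ne show False by contradiction
qed

text \<open>
  Let \<open>f = y \<cdot> e \<cdot> x\<close>. Hypocentrality for the factorization \<open>x \<cdot> y = e\<close> gives \<open>f \<le> e\<close>.
  Replacing \<open>y\<close> by \<open>y' = y \<cdot> e\<close> keeps \<open>x \<cdot> y' = e\<close> and makes \<open>f = y' \<cdot> x\<close> the product
  in the opposite order. Hypocentrality for this second factorization gives \<open>e \<le> f\<close>.
  Commutativity of idempotents makes one-sided comparisons two-sided.
\<close>

lemma factorizations_rotate_if_hypocentral:
  assumes hyp: "E_hypocentral mul" and comm: "E_commutative mul"
  shows factorizations_rotate
  unfolding factorizations_rotate_def
proof (intro ballI allI impI)
  fix e x y
  assume e: "e \<in> idempotents mul" and xy: "x \<cdot> y = e"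
  define y' where "y' = y \<cdot> e"
  define f where "f = y' \<cdot> x"
  have ee: "e \<cdot> e = e"
    using e by (simp add: idempotents_def)
  have xy': "x \<cdot> y' = e"
    by (simp add: y'_def xy ee flip: mul_assoc)
  have f: "f \<in> idempotents mul"
    using rotated_factorization_idempotent[OF xy e] by (simp add: f_def y'_def)
  have ef: "e \<cdot> f = f \<cdot> e"
    using comm e f by (simp add: E_commutative_def)
  have fy': "f \<cdot> y' = y'"
    by (simp add: f_def mul_assoc xy') (simp add: y'_def mul_assoc ee)
  have xf: "x \<cdot> f = e \<cdot> x"
    by (simp add: f_def xy' flip: mul_assoc)
  have "f \<cdot> e = f"
    using hyp e xy unfolding E_hypocentral_def
  proof (elim ballE allE impE disjE)
    assume "x \<cdot> e = e \<cdot> x"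
    then show ?thesis
      by (metis f_def y'_def mul_assoc ee)
  next
    assume "y \<cdot> e = e \<cdot> y"
    then have "e \<cdot> f = f"
      by (metis f_def y'_def mul_assoc ee)
    then show ?thesis by (simp add: ef)
  qed auto
  moreover have "e \<cdot> f = e"
  proof -
    have "y' \<cdot> f = f \<cdot> y' \<or> x \<cdot> f = f \<cdot> x"
      using hyp f f_def unfolding E_hypocentral_def by blast
    then show ?thesis
    proof
      assume "y' \<cdot> f = f \<cdot> y'"
      then have "x \<cdot> (y' \<cdot> f) = x \<cdot> y'" by (simp add: fy')
      then show ?thesis by (simp add: xy' flip: mul_assoc)
    next
      assume "x \<cdot> f = f \<cdot> x"
      then have "f \<cdot> (x \<cdot> y') = e \<cdot> (x \<cdot> y')" by (simp add: xf flip: mul_assoc)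
      then show ?thesis by (simp add: xy' ee ef)
    qed
  qed
  ultimately have "f = e" by (simp add: ef)
  then show "y \<cdot> e \<cdot> x = e" by (simp add: f_def y'_def)
qed

section \<open>Centrality of idempotents\<close>

lemma commutes_with_left_divisor:
  assumes factorizations_rotate and e: "e \<in> idempotents mul" and xy: "x \<cdot> y = e"
  shows "x \<cdot> e = e \<cdot> x"
proof -
  have "y \<cdot> e \<cdot> x = e"
    using assms by (simp add: factorizations_rotate_def)
  then have "x \<cdot> e = x \<cdot> y \<cdot> (e \<cdot> x)" by (simp add: mul_assoc)
  also have "\<dots> = e \<cdot> x"
    using e by (simp add: xy idempotents_def flip: mul_assoc)
  finally show ?thesis .
qed

lemma hypocentral_if_rotate:
  assumes factorizations_rotate
  shows "E_hypocentral mul"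
  using commutes_with_left_divisor[OF assms] by (auto simp: E_hypocentral_def)

text \<open>
  For idempotents \<open>e\<close> and \<open>f\<close> the product \<open>e \<cdot> f\<close> is idempotent, and its rotation
  \<open>f \<cdot> (e \<cdot> f) \<cdot> e\<close> is the square of the idempotent \<open>f \<cdot> e\<close>.
\<close>

lemma commutative_if_rotate:
  assumes rot: factorizations_rotate and "E_semigroup mul"
  shows "E_commutative mul"
  unfolding E_commutative_def
proof (intro ballI)
  fix e f
  assume "e \<in> idempotents mul" "f \<in> idempotents mul"
  then have ef: "e \<cdot> f \<in> idempotents mul" and fe: "f \<cdot> e \<in> idempotents mul"
    using assms by (auto simp: E_semigroup_def)
  have "f \<cdot> (e \<cdot> f) \<cdot> e = e \<cdot> f"
    using rot ef by (simp add: factorizations_rotate_def)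
  moreover have "f \<cdot> (e \<cdot> f) \<cdot> e = f \<cdot> e"
    using fe by (simp add: idempotents_def mul_assoc)
  ultimately show "e \<cdot> f = f \<cdot> e" by simp
qed

section \<open>Powers and maximal subgroups\<close>

lemma spow_Suc_0: "spow mul x (Suc 0) = x"
  by (simp add: spow_def)

lemma spow_Suc: "n \<ge> 1 \<Longrightarrow> spow mul x (Suc n) = x \<cdot> spow mul x n"
  by (cases n) (simp_all add: spow_def)

lemma spow_left_divisor: "n \<ge> 1 \<Longrightarrow> \<exists>w. spow mul x n \<cdot> z = x \<cdot> w"
  by (induction n rule: dec_induct) (auto simp: spow_Suc_0 spow_Suc mul_assoc)

lemma spow_idempotent: "n \<ge> 1 \<Longrightarrow> x \<in> idempotents mul \<Longrightarrow> spow mul x n = x"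
  by (induction n rule: dec_induct) (auto simp: spow_Suc_0 spow_Suc idempotents_def)

lemma right_ideal1_idempotent:
  "e \<in> idempotents mul \<Longrightarrow> x \<in> right_ideal1 mul e \<Longrightarrow> e \<cdot> x = x"
  by (auto simp: idempotents_def right_ideal1_def simp flip: mul_assoc)

lemma left_ideal1_idempotent:
  "e \<in> idempotents mul \<Longrightarrow> x \<in> left_ideal1 mul e \<Longrightarrow> x \<cdot> e = x"
  by (auto simp: idempotents_def left_ideal1_def mul_assoc)

lemma idempotent_in_H_class:
  assumes e: "e \<in> idempotents mul" and f: "f \<in> idempotents mul" and "f \<in> H_class mul e"
  shows "f = e"
proof -
  have "f \<in> right_ideal1 mul e" "e \<in> left_ideal1 mul f"
    using assms by (auto simp: H_class_def right_ideal1_def left_ideal1_def)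
  then show ?thesis
    using right_ideal1_idempotent[OF e] left_ideal1_idempotent[OF f] by metis
qed

lemma in_H_classI:
  assumes ay: "a \<cdot> y = e" and ya: "y \<cdot> a = e" and ea: "e \<cdot> a = a" and ae: "a \<cdot> e = a"
  shows "a \<in> H_class mul e"
proof -
  have "right_ideal1 mul a = right_ideal1 mul e"
    unfolding right_ideal1_def using ay ea mul_assoc by (auto, metis+)
  moreover have "left_ideal1 mul a = left_ideal1 mul e"
    unfolding left_ideal1_def using ya ae mul_assoc by (auto, metis+)
  ultimately show ?thesis by (simp add: H_class_def)
qed

text \<open>
  If a power of \<open>x\<close> lies in \<open>H\<^sub>f\<close> and \<open>e \<le> f\<close>, then \<open>x\<close> divides \<open>f\<close>, hence also
  \<open>e = f \<cdot> e\<close>, from the left.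
\<close>

lemma upcentral_if_rotate:
  assumes rot: factorizations_rotate
  shows "E_upcentral mul"
  unfolding E_upcentral_def
proof (intro ballI impI)
  fix e f x
  assume e: "e \<in> idempotents mul" and "f \<cdot> e = e \<and> e = e \<cdot> f"
    and "x \<in> root_set mul (H_class mul f)"
  then obtain n where n: "n \<ge> 1" and H: "spow mul x n \<in> H_class mul f" and fe: "f \<cdot> e = e"
    by (auto simp: root_set_def)
  have "f \<in> right_ideal1 mul (spow mul x n)"
    using H by (auto simp: H_class_def right_ideal1_def)
  then obtain z where "f \<cdot> e = spow mul x n \<cdot> z"
    by (auto simp: right_ideal1_def mul_assoc)
  then obtain w where "x \<cdot> w = e"
    using spow_left_divisor[OF n, of x z] fe by metis
  then show "x \<cdot> e = e \<cdot> x"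
    by (rule commutes_with_left_divisor[OF rot e])
qed

section \<open>Characters\<close>

lemma character_mul: "\<chi> \<in> characters mul \<Longrightarrow> \<chi> (x \<cdot> y) = \<chi> x * \<chi> y"
  by (simp add: characters_def semigroup_hom_def)

lemma character_values: "\<chi> \<in> characters mul \<Longrightarrow> \<chi> x = 0 \<or> \<chi> x = 1"
  by (auto simp: characters_def)

lemma character_spow:
  assumes \<chi>: "\<chi> \<in> characters mul" and "n \<ge> 1"
  shows "\<chi> (spow mul x n) = \<chi> x"
  using \<open>n \<ge> 1\<close>
  by (induction n rule: dec_induct)
    (use character_values[OF \<chi>, of x] in
      \<open>auto simp: spow_Suc_0 spow_Suc character_mul[OF \<chi>]\<close>)

lemma character_right_ideal1:
  assumes \<chi>: "\<chi> \<in> characters mul" and "x \<in> right_ideal1 mul a"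
  shows "\<chi> x \<le> \<chi> a"
proof -
  have "\<chi> (a \<cdot> y) \<le> \<chi> a" for y
    using character_values[OF \<chi>, of y] by (auto simp: character_mul[OF \<chi>])
  then show ?thesis
    using assms by (auto simp: right_ideal1_def)
qed

lemma character_H_class:
  assumes "\<chi> \<in> characters mul" and "a \<in> H_class mul e"
  shows "\<chi> a = \<chi> e"
proof (rule antisym)
  have "a \<in> right_ideal1 mul e" "e \<in> right_ideal1 mul a"
    using assms by (auto simp: H_class_def right_ideal1_def)
  then show "\<chi> a \<le> \<chi> e" "\<chi> e \<le> \<chi> a"
    using character_right_ideal1 assms by auto
qed

lemma character_root_set:
  assumes "\<chi> \<in> characters mul" and "x \<in> root_set mul (H_class mul e)"
  shows "\<chi> x = \<chi> e"
  using assms character_spow character_H_class by (fastforce simp: root_set_def)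

lemma updown_iff: "x \<in> updown mul a \<longleftrightarrow> (\<forall>\<chi> \<in> characters mul. \<chi> x = \<chi> a)"
  by (auto simp: updown_def char_le_def intro: antisym)

text \<open>
  On \<open>{0, 1}\<close> multiplication agrees with the semilattice operation \<open>min\<close>.
\<close>

lemma separated_if_characters_separate:
  assumes "\<And>e f. e \<in> idempotents mul \<Longrightarrow> f \<in> idempotents mul \<Longrightarrow>
             \<forall>\<chi> \<in> characters mul. \<chi> e = \<chi> f \<Longrightarrow> e = f"
  shows "E_separated mul"
  unfolding E_separated_def
proof (intro ballI impI)
  fix e f
  assume "e \<in> idempotents mul" "f \<in> idempotents mul" "e \<noteq> f"
  then obtain \<chi> where \<chi>: "\<chi> \<in> characters mul" and ne: "\<chi> e \<noteq> \<chi> f"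
    using assms by blast
  have "\<chi> x * \<chi> y = min (\<chi> x) (\<chi> y)" for x y
    using character_values[OF \<chi>, of x] character_values[OF \<chi>, of y] by auto
  then have "semigroup_hom mul min \<chi>"
    by (simp add: semigroup_hom_def character_mul[OF \<chi>])
  then show "\<exists>(g :: 'a set \<Rightarrow> 'a set \<Rightarrow> 'a set) h.
               semilattice g \<and> semigroup_hom mul g h \<and> h e \<noteq> h f"
    by (rule semilattice_hom_to_set[where h = \<chi>, OF min.semilattice_axioms _ ne])
qed

definition divides_indicator :: "'a \<Rightarrow> 'a \<Rightarrow> nat" where
  "divides_indicator e x = (if \<exists>w. x \<cdot> w = e then 1 else 0)"

text \<open>
  Rotating \<open>x \<cdot> w = e\<close> exhibits \<open>x\<close> as a right divisor, since \<open>(w \<cdot> e) \<cdot> x = e\<close>; rotating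
  \<open>w \<cdot> x = e\<close> exhibits it as a left divisor, since \<open>x \<cdot> (e \<cdot> w) = e\<close>.
\<close>

lemma left_divisor_iff_right_divisor:
  assumes factorizations_rotate and "e \<in> idempotents mul"
  shows "(\<exists>w. x \<cdot> w = e) \<longleftrightarrow> (\<exists>w. w \<cdot> x = e)"
  using assms unfolding factorizations_rotate_def by (metis mul_assoc)

text \<open>
  If \<open>x \<cdot> y\<close> divides \<open>e\<close> from the left, then so does \<open>x\<close>; it also divides \<open>e\<close> from the
  right, and then so does \<open>y\<close>. Conversely, if \<open>x \<cdot> u = e\<close> and \<open>y \<cdot> v = e\<close>, then
  \<open>x \<cdot> y \<cdot> (v \<cdot> u) = x \<cdot> e \<cdot> u\<close>, and \<open>e\<close> can be moved past its divisor \<open>x\<close>.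
\<close>

lemma divides_indicator_character:
  assumes rot: factorizations_rotate and e: "e \<in> idempotents mul"
  shows "divides_indicator e \<in> characters mul"
proof -
  have "(\<exists>w. x \<cdot> y \<cdot> w = e) \<longleftrightarrow> (\<exists>w. x \<cdot> w = e) \<and> (\<exists>w. y \<cdot> w = e)" for x y
  proof
    assume xy: "\<exists>w. x \<cdot> y \<cdot> w = e"
    then have "\<exists>w. w \<cdot> (x \<cdot> y) = e"
      using left_divisor_iff_right_divisor[OF rot e] by blast
    then have "\<exists>w. w \<cdot> y = e"
      by (metis mul_assoc)
    then have "\<exists>w. y \<cdot> w = e"
      using left_divisor_iff_right_divisor[OF rot e] by blast
    moreover have "\<exists>w. x \<cdot> w = e"
      using xy by (metis mul_assoc)
    ultimately show "(\<exists>w. x \<cdot> w = e) \<and> (\<exists>w. y \<cdot> w = e)" by blast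
  next
    assume "(\<exists>w. x \<cdot> w = e) \<and> (\<exists>w. y \<cdot> w = e)"
    then obtain u v where u: "x \<cdot> u = e" and v: "y \<cdot> v = e" by blast
    have "x \<cdot> y \<cdot> (v \<cdot> u) = x \<cdot> (y \<cdot> v) \<cdot> u" by (simp only: mul_assoc)
    also have "\<dots> = e \<cdot> (x \<cdot> u)"
      by (simp add: v commutes_with_left_divisor[OF rot e u] mul_assoc)
    also have "\<dots> = e"
      using e by (simp add: u idempotents_def)
    finally show "\<exists>w. x \<cdot> y \<cdot> w = e" by blast
  qed
  then show ?thesis
    by (auto simp: characters_def semigroup_hom_def divides_indicator_def)
qed

text \<open>
  An idempotent \<open>a\<close> dividing an idempotent \<open>b\<close> satisfies \<open>b \<le> a\<close>. If all characters agree
  on \<open>e\<close> and \<open>f\<close>, then their divisor indicators show that each divides the other.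
\<close>

lemma characters_separate_if_rotate:
  assumes rot: factorizations_rotate
    and e: "e \<in> idempotents mul" and f: "f \<in> idempotents mul"
    and eq: "\<forall>\<chi> \<in> characters mul. \<chi> e = \<chi> f"
  shows "e = f"
proof -
  have below: "a \<cdot> b = b \<and> b \<cdot> a = b"
    if a: "a \<in> idempotents mul" and b: "b \<in> idempotents mul"
      and ab: "\<forall>\<chi> \<in> characters mul. \<chi> a = \<chi> b" for a b
  proof -
    have "divides_indicator b b = 1"
      using b by (auto simp: divides_indicator_def idempotents_def)
    then have "divides_indicator b a = 1"
      using ab divides_indicator_character[OF rot b] by metis
    then obtain w where w: "a \<cdot> w = b"
      by (auto simp: divides_indicator_def split: if_splits)
    then have "a \<cdot> b = b"
      using a by (auto simp: idempotents_def simp flip: mul_assoc)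
    then show ?thesis
      using commutes_with_left_divisor[OF rot b w] by simp
  qed
  have "e \<cdot> f = f" using below[OF e f] eq by simp
  moreover have "e \<cdot> f = e" using below[OF f e] eq by metis
  ultimately show ?thesis by simp
qed

section \<open>Root sets of maximal subgroups\<close>

text \<open>
  Rotating the idempotent \<open>e = a \<cdot> y\<close> of a regular power \<open>a = a \<cdot> y \<cdot> a\<close> gives
  \<open>e = y \<cdot> (e \<cdot> a) = y \<cdot> a\<close>, so \<open>y\<close> is a two-sided inverse of \<open>a\<close> with respect to \<open>e\<close>.
\<close>

lemma in_root_of_H_class:
  assumes rot: factorizations_rotate and "pi_regular mul"
  obtains e where "e \<in> idempotents mul" and "x \<in> root_set mul (H_class mul e)"
proof -
  obtain n y where n: "n \<ge> 1" and reg: "spow mul x n = spow mul x n \<cdot> y \<cdot> spow mul x n"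
    using assms unfolding pi_regular_def by blast
  define a where "a = spow mul x n"
  define e where "e = a \<cdot> y"
  have ea: "e \<cdot> a = a"
    unfolding a_def e_def by (rule reg[symmetric])
  then have e: "e \<in> idempotents mul"
    by (simp add: idempotents_def e_def flip: mul_assoc)
  then have "y \<cdot> e \<cdot> a = e"
    using rot e_def unfolding factorizations_rotate_def by blast
  then have ya: "y \<cdot> a = e"
    by (simp add: ea mul_assoc)
  then have "a \<cdot> e = a"
    using ea by (metis e_def mul_assoc)
  then have "a \<in> H_class mul e"
    by (intro in_H_classI[OF e_def[symmetric] ya ea])
  then show thesis
    using n e that by (auto simp: root_set_def a_def)
qed

lemma updown_eq_root_if_rotate:
  assumes rot: factorizations_rotate and "pi_regular mul" and e: "e \<in> idempotents mul"
  shows "updown mul e = root_set mul (H_class mul e)"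
proof
  show "root_set mul (H_class mul e) \<subseteq> updown mul e"
    using character_root_set by (auto simp: updown_iff)
  show "updown mul e \<subseteq> root_set mul (H_class mul e)"
  proof
    fix x
    assume x: "x \<in> updown mul e"
    obtain f where f: "f \<in> idempotents mul" and xf: "x \<in> root_set mul (H_class mul f)"
      using in_root_of_H_class[OF assms(1,2)] by blast
    have "\<forall>\<chi> \<in> characters mul. \<chi> e = \<chi> f"
      using x character_root_set[OF _ xf] unfolding updown_iff by metis
    then have "e = f"
      by (rule characters_separate_if_rotate[OF rot e f])
    with xf show "x \<in> root_set mul (H_class mul e)" by simp
  qed
qed

text \<open>
  An idempotent that all characters identify with \<open>e\<close> has a power in \<open>H\<^sub>e\<close>. It equals this
  power, and \<open>e\<close> is the only idempotent of the group \<open>H\<^sub>e\<close>.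
\<close>

lemma separated_if_updown_eq_root:
  assumes "\<forall>e \<in> idempotents mul. updown mul e = root_set mul (H_class mul e)"
  shows "E_separated mul"
proof (rule separated_if_characters_separate)
  fix e f
  assume e: "e \<in> idempotents mul" and f: "f \<in> idempotents mul"
    and "\<forall>\<chi> \<in> characters mul. \<chi> e = \<chi> f"
  then have "f \<in> updown mul e"
    by (metis updown_iff)
  then have "f \<in> root_set mul (H_class mul e)"
    using assms e by blast
  then have "f \<in> H_class mul e"
    using spow_idempotent[OF _ f] by (auto simp: root_set_def)
  then show "e = f"
    using idempotent_in_H_class[OF e f] by simp
qed

end

theorem theorem5p2:
  fixes mul :: "'a \<Rightarrow> 'a \<Rightarrow> 'a"
  assumes "semigroup mul"
    and "pi_regular mul"
    and "E_semigroup mul"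
  shows "((\<forall>e \<in> idempotents mul. updown mul e = root_set mul (H_class mul e))
            \<longleftrightarrow> E_separated mul)
       \<and> (E_separated mul
            \<longleftrightarrow> E_upcentral mul \<and> E_hypocentral mul \<and> E_commutative mul)"
proof (intro conjI iffI)
  assume "\<forall>e \<in> idempotents mul. updown mul e = root_set mul (H_class mul e)"
  then show "E_separated mul"
    by (rule separated_if_updown_eq_root[OF assms(1)])
next
  assume "E_separated mul"
  then have rot: "factorizations_rotate mul"
    by (rule factorizations_rotate_if_separated[OF assms(1)])
  show "\<forall>e \<in> idempotents mul. updown mul e = root_set mul (H_class mul e)"
    by (intro ballI updown_eq_root_if_rotate[OF assms(1) rot assms(2)])
  show "E_upcentral mul"
    by (rule upcentral_if_rotate[OF assms(1) rot])
  show "E_hypocentral mul"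
    by (rule hypocentral_if_rotate[OF assms(1) rot])
  show "E_commutative mul"
    by (rule commutative_if_rotate[OF assms(1) rot assms(3)])
next
  assume "E_upcentral mul \<and> E_hypocentral mul \<and> E_commutative mul"
  then have rot: "factorizations_rotate mul"
    by (elim conjE) (rule factorizations_rotate_if_hypocentral[OF assms(1)])
  show "E_separated mul"
    by (rule separated_if_characters_separate[OF assms(1)])
      (rule characters_separate_if_rotate[OF assms(1) rot])
qed

end
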